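(* Let $G$ be a finite directed multigraph and let $H\subseteq G$ be its largest full subgraph. Then the cycle polytope $P(G)$ has dimension $$\dim P(G)=|E(H)|-|V(H)|+|\{\text{connected components of } H\}|-1.$$ In particular, if $G$ is strongly connected, then $\dim P(G)=|E(G)|-|V(G)|$.
   Context: Directed multigraphs may have multiple edges and loops. A cycle in $G=(V,E)$ is a closed walk $e_1,\dots,e_n$ of edges ($n\ge1$, the head of $e_i$ is the tail of $e_{i+1}$, indices mod $n$), of length $|\mathcal C|=n$; it is simple if it does not repeat vertices (a loop is a simple cycle of length 1). For a non-empty cycle $\mathcal C$, $\vec e_{\mathcal C}\in\mathbb R^E$ is defined by $(\vec e_{\mathcal C})_e=(\text{number of occurrences of } e \text{ in } \mathcal C)/|\mathcal C|$. The cycle polytope is $P(G)=\operatorname{conv}\{\vec e_{\mathcal C}: \mathcal C \text{ a simple cycle of } G\}$. A directed multigraph is full if every edge is contained in a cycle; the largest full subgraph $H$ of $G$ is the subgraph consisting of all edges of $G$ that lie on some cycle of $G$, together with their endpoints. Connected components are taken in the (weak) connectivity sense. The dimension of a polytope is the dimension of its affine hull (the empty set has dimension $-1$). *)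

theory Defs
  imports "HOL-Analysis.Analysis" "Graph_Theory.Digraph_Component"
begin

text \<open>
  A directed multigraph is a \<open>pre_digraph\<close>; \<open>fin_digraph\<close> admits parallel arcs and loops. An
  arbitrary cycle of length at least one is the library's \<open>closed_w\<close>, whereas the library's \<open>cycle\<close>
  does not repeat vertices, i.e. it is a simple cycle (a loop being one of length 1). Both are
  lists of arcs with a marked starting point, on which the vector below does not depend.

  The edge set is the set \<open>arcs G\<close> (possibly empty, possibly all of the type) of a finite type
  \<open>'e\<close>, and \<open>\<real>\<^sup>E\<close> is realised as the coordinate subspace of \<^typ>\<open>real ^ 'e\<close> of vectors vanishing
  off \<open>arcs G\<close>.
\<close>

definition cycle_vec :: "'e list \<Rightarrow> real ^ 'e::finite" where
  "cycle_vec p = (\<chi> e. real (count_list p e) / real (length p))"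

definition cycle_polytope :: "('v, 'e::finite) pre_digraph \<Rightarrow> (real ^ 'e) set" where
  "cycle_polytope G = convex hull {cycle_vec p | p. pre_digraph.cycle G p}"

definition full_digraph :: "('v, 'e) pre_digraph \<Rightarrow> bool" where
  "full_digraph G \<longleftrightarrow> (\<forall>e \<in> arcs G. \<exists>p. wf_digraph.closed_w G p \<and> e \<in> set p)"

definition largest_full_subgraph :: "('v, 'e) pre_digraph \<Rightarrow> ('v, 'e) pre_digraph" where
  "largest_full_subgraph G =
    (let F = {e \<in> arcs G. \<exists>p. wf_digraph.closed_w G p \<and> e \<in> set p}
     in \<lparr> verts = tail G ` F \<union> head G ` F, arcs = F, tail = tail G, head = head G \<rparr>)"

text \<open>
  Maximality of \<open>largest_full_subgraph\<close> is with respect to arcs: isolated vertices, whose presence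
  does not affect fullness, are left out.
\<close>

lemma largest_full_subgraph_subgraph:
  assumes "wf_digraph G"
  shows "subgraph (largest_full_subgraph G) G"
  using assms
  by (auto simp: subgraph_def largest_full_subgraph_def compatible_def wf_digraph_def Let_def)

lemma full_digraph_largest_full_subgraph:
  fixes G :: "('v, 'e) pre_digraph"
  assumes "wf_digraph G"
  shows "full_digraph (largest_full_subgraph G)"
  unfolding full_digraph_def
proof
  let ?H = "largest_full_subgraph G"
  interpret wf_digraph G by fact
  fix e assume "e \<in> arcs ?H"
  then obtain p where p: "closed_w p" "e \<in> set p"
    by (auto simp: largest_full_subgraph_def Let_def)
  then obtain u where u: "awalk u p u" "p \<noteq> []" by (auto simp: closed_w_def)
  have arcs: "set p \<subseteq> arcs ?H"
    using p u by (auto simp: largest_full_subgraph_def Let_def awalk_def)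
  have "tail G (hd p) = u" using u by (cases p) (auto simp: awalk_def)
  moreover have "hd p \<in> arcs ?H" using arcs u by auto
  ultimately have "u \<in> verts ?H" by (auto simp: largest_full_subgraph_def Let_def)
  moreover have "compatible G ?H" and wf: "wf_digraph ?H"
    using largest_full_subgraph_subgraph[OF assms] by (auto simp: subgraph_def)
  ultimately have "pre_digraph.awalk ?H u p u"
    using u arcs by (auto simp: pre_digraph.awalk_def compatible_cas)
  then show "\<exists>p. wf_digraph.closed_w ?H p \<and> e \<in> set p"
    using p u by (auto simp: wf_digraph.closed_w_def[OF wf])
qed

lemma full_subgraph_arcs_le:
  assumes "subgraph K G" "full_digraph K"
  shows "arcs K \<subseteq> arcs (largest_full_subgraph G)"
proof
  have wf: "wf_digraph K" "wf_digraph G" using assms(1) by (auto simp: subgraph_def)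
  fix e assume e: "e \<in> arcs K"
  then obtain p u where p: "e \<in> set p" "pre_digraph.awalk K u p u" "p \<noteq> []"
    using assms(2) by (auto simp: full_digraph_def wf_digraph.closed_w_def[OF wf(1)])
  have "pre_digraph.awalk G u p u"
    using p assms(1) compatible_cas[of G K]
    by (auto simp: pre_digraph.awalk_def subgraph_def)
  then show "e \<in> arcs (largest_full_subgraph G)"
    using e p assms(1)
    by (auto simp: largest_full_subgraph_def Let_def wf_digraph.closed_w_def[OF wf(2)] subgraph_def)
qed

text \<open>
  Weak components: \<open>Digraph_Component.connected\<close> forgets the directions of the arcs and
  requires a vertex, so the digraph without vertices has no component.
\<close>

definition weak_components :: "('v, 'e) pre_digraph \<Rightarrow> ('v, 'e) pre_digraph set" where
  "weak_components G = {C. pre_digraph.max_subgraph G Digraph_Component.connected C}"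

end

theory Submission
  imports Defs
begin

text \<open>
  Cycle vectors lie on the hyperplane of coordinate sum 1, so \<open>dim P(G)\<close> is one less than the
  dimension of their linear span. In a full digraph reachability is symmetric, so the weak components
  are the strong ones. A vector of \<open>\<real>\<^sup>E\<close> orthogonal to all simple cycles sums to zero
  along every closed walk, hence is the coboundary of a potential on the vertices; as the kernel of
  the coboundary consists of the potentials constant on components, the orthogonal complement of the
  span has dimension \<open>|V| - c\<close>, where \<open>c\<close> is the number of components.
\<close>

section \<open>Reachability and components in full digraphs\<close>

text \<open>Each arc \<open>e\<close> lies on a closed walk \<open>q @ e # r\<close>; following
  \<open>r\<close> and then \<open>q\<close> leads from the head of \<open>e\<close> back to its
  tail. A walk is thus reversed arc by arc.\<close>

lemma (in wf_digraph) full_reachable_sym: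
  assumes "full_digraph G" "u \<rightarrow>\<^sup>* v"
  shows "v \<rightarrow>\<^sup>* u"
  using assms(2)
proof (induction rule: reachable_induct)
  case base
  then show ?case by simp
next
  case (step x y)
  then obtain e where e: "e \<in> arcs G" "tail G e = x" "head G e = y"
    by auto
  then obtain w p where p: "awalk w p w" "e \<in> set p"
    using assms(1) by (auto simp: full_digraph_def closed_w_def)
  then obtain q r where "p = q @ e # r"
    by (meson split_list)
  with p e have "awalk y r w" "awalk w q x"
    by (auto simp: awalk_simps)
  then have "y \<rightarrow>\<^sup>* x"
    using reachable_awalk reachable_trans by blast
  with step show ?case
    using reachable_trans by blast
qed

text \<open>A step in the symmetric closure of \<open>C\<close> is an arc of \<open>C\<close> taken
  forwards or backwards, and fullness of \<open>G\<close> replaces a backward step by a directed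
  walk. That walk may leave \<open>C\<close>, so reachability is claimed in \<open>G\<close>
  only.\<close>

lemma (in wf_digraph) full_connected_subgraph_reachable:
  assumes "full_digraph G" "subgraph C G" "Digraph_Component.connected C"
    and "u \<in> verts C" "v \<in> verts C"
  shows "u \<rightarrow>\<^sup>* v"
proof -
  have "u \<rightarrow>\<^sup>*\<^bsub>mk_symmetric C\<^esub> v"
    using assms by (auto simp: connected_def strongly_connected_def)
  then have "(u, v) \<in> rtrancl_on (verts C) (parcs (mk_symmetric C))"
    by (simp add: reachable_def)
  then show ?thesis
  proof (induction rule: rtrancl_on_induct)
    case base
    then show ?case using assms by auto
  next
    case (step x y)
    then obtain e where e: "e \<in> arcs C" "(x, y) = (tail C e, head C e) \<or> (x, y) = (head C e, tail C e)"
      by (auto simp: parcs_mk_symmetric)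
    have "e \<in> arcs G" "tail C e = tail G e" "head C e = head G e"
      using e assms(2) by (auto simp: compatible_def)
    then have "tail C e \<rightarrow>\<^sup>* head C e"
      by (metis in_arcs_imp_in_arcs_ends reachable_adjI)
    then have "x \<rightarrow>\<^sup>* y"
      using e full_reachable_sym[OF assms(1)] by auto
    then show ?case
      using step reachable_trans by blast
  qed
qed

text \<open>A connected subgraph lies inside the strong component of any of its vertices, and strong
  components are themselves connected. So the maximal connected subgraphs are the strong
  components.\<close>

lemma (in wf_digraph) full_weak_components_eq_sccs:
  assumes "full_digraph G"
  shows "weak_components G = sccs"
proof -
  have sub: "subgraph C (G \<restriction> scc_of u)"
    if C: "subgraph C G" "Digraph_Component.connected C" "u \<in> verts C" for C u
  proof -
    have "verts C \<subseteq> scc_of u"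
      using full_connected_subgraph_reachable[OF assms C(1,2)] C(3) by (auto simp: scc_of_def)
    then show ?thesis
      using C(1) wf_digraph.wellformed[of C]
      by (auto simp: subgraph_def compatible_def wellformed_induce_subgraph subset_iff)
  qed
  have scc: "G \<restriction> scc_of u \<in> sccs" if "u \<in> verts G" for u
    using that by (simp add: in_verts_sccsD_sccs scc_of_in_sccs_verts)
  have conn: "Digraph_Component.connected C" if "C \<in> sccs" for C
    using that
    by (auto simp: connected_def strongly_connected_def
        intro!: wf_digraph.reachable_mk_symmetricI elim!: in_sccsE)
  have sccD: "\<exists>u\<in>verts G. C = G \<restriction> scc_of u" if "C \<in> sccs" for C
    using that sccs_conv_sccs_verts sccs_verts_conv_scc_of by auto
  show ?thesis
  proof (intro equalityI subsetI)
    fix C assume "C \<in> weak_components G"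
    then have C: "max_subgraph Digraph_Component.connected C"
      by (simp add: weak_components_def)
    then have C': "subgraph C G" "Digraph_Component.connected C"
      by (auto simp: max_subgraph_def)
    then obtain u where u: "u \<in> verts C"
      by (auto simp: connected_def strongly_connected_def)
    then have "u \<in> verts G" using C' by auto
    note D = scc[OF this]
    have "subgraph (G \<restriction> scc_of u) G"
      using D by auto
    with C sub[OF C' u] conn[OF D] have "C = G \<restriction> scc_of u"
      by (auto simp: max_subgraph_def)
    then show "C \<in> sccs" using D by simp
  next
    fix C assume C: "C \<in> sccs"
    then obtain u where u: "u \<in> verts G" "C = G \<restriction> scc_of u"
      using sccD by auto
    \<comment> \<open>Maximality: a connected \<open>D\<close> above \<open>C\<close> contains
      \<open>u\<close>, hence lies inside the component of \<open>u\<close>, which is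
      \<open>C\<close>.\<close>
    have "D = C" if D: "subgraph C D" "subgraph D G" "Digraph_Component.connected D" for D
    proof -
      have "u \<in> verts D"
        using subgraph_imp_subverts[OF D(1)] u(2) in_scc_of_self[OF u(1)] by auto
      then have "subgraph D C"
        using sub D u by auto
      then show ?thesis
        using D(1) by (auto simp: subgraph_def compatible_def)
    qed
    then show "C \<in> weak_components G"
      using conn[OF C] C by (auto simp: weak_components_def max_subgraph_def)
  qed
qed

section \<open>From vanishing cycle sums to potentials\<close>

text \<open>A nonempty closed walk that is not a simple cycle revisits a vertex and splits there
  into two shorter closed walks.\<close>

lemma (in wf_digraph) closed_walk_sum_eq_0:
  fixes y :: "'b \<Rightarrow> 'c::ab_group_add"
  assumes "\<And>p. cycle p \<Longrightarrow> sum_list (map y p) = 0" "awalk u p u"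
  shows "sum_list (map y p) = 0"
  using assms(2)
proof (induction "length p" arbitrary: u p rule: less_induct)
  case less
  show ?case
  proof (cases "p = [] \<or> cycle p")
    case True
    then show ?thesis using assms(1) by auto
  next
    case False
    then obtain e es where p: "p = e # es"
      by (cases p) auto
    with False less.prems
    \<comment> \<open>Dropping the first arc leaves a vertex list that counts the base point
      \<open>u\<close> only once, so a repetition in it is a genuine one. The cut-out walk
      \<open>r\<close> is nonempty and avoids the initial \<open>e\<close>, which makes both pieces
      strictly shorter than \<open>p\<close>.\<close>
    have "awalk (head G e) es u" "\<not> distinct (awalk_verts (head G e) es)"
      by (auto simp: awalk_Cons_iff cycle_def)
    from awalk_not_distinct_decomp[OF this] obtain q r s w where
      qrs: "es = q @ r @ s" "0 < length r" "awalk (head G e) q w" "awalk w r w" "awalk w s u"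
      by blast
    have "awalk u ((e # q) @ s) u"
      using qrs less.prems p by (auto simp: awalk_Cons_iff)
    then have "sum_list (map y ((e # q) @ s)) = 0"
      using qrs(1,2) p by (intro less.hyps) auto
    moreover have "sum_list (map y r) = 0"
      using qrs(1,2,4) p by (intro less.hyps) auto
    ultimately show ?thesis
      by (simp add: p qrs(1) algebra_simps)
  qed
qed

text \<open>The potential at \<open>v\<close> is the sum of \<open>y\<close> along a chosen walk to
  \<open>v\<close> from a base point of its strong component. The choice of walk is harmless because
  two walks with the same ends can be closed up by one return walk.\<close>

lemma (in wf_digraph) full_potential_exists:
  fixes y :: "'b \<Rightarrow> 'c::ab_group_add"
  assumes full: "full_digraph G"
    and closed: "\<And>u p. awalk u p u \<Longrightarrow> sum_list (map y p) = 0"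
  obtains \<phi> where "\<And>e. e \<in> arcs G \<Longrightarrow> y e = \<phi> (head G e) - \<phi> (tail G e)"
proof -
  \<comment> \<open>The choice depends on the set \<open>scc_of v\<close> alone, so all vertices of
    one component share a base point.\<close>
  define r where "r v = (SOME w. w \<in> scc_of v)" for v
  define P where "P v = (SOME p. awalk (r v) p v)" for v
  define \<phi> where "\<phi> v = sum_list (map y (P v))" for v
  have r: "r v \<in> scc_of v" if "v \<in> verts G" for v
    using someI[of "\<lambda>w. w \<in> scc_of v"] in_scc_of_self[OF that] by (auto simp: r_def)
  have P: "awalk (r v) (P v) v" if "v \<in> verts G" for v
    using r[OF that] someI_ex[of "\<lambda>p. awalk (r v) p v"]
    by (auto simp: P_def scc_of_def reachable_awalk)
  have "y e = \<phi> (head G e) - \<phi> (tail G e)" if e: "e \<in> arcs G" for e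
  proof -
    let ?t = "tail G e" and ?h = "head G e"
    have V: "?t \<in> verts G" "?h \<in> verts G" using e by auto
    have "?t \<rightarrow>\<^sup>* ?h"
      using e by (metis in_arcs_imp_in_arcs_ends reachable_adjI)
    then have "?t \<in> scc_of ?h"
      using full_reachable_sym[OF full] by (auto simp: scc_of_def)
    then have req: "r ?t = r ?h"
      by (simp add: r_def scc_of_eq)
    obtain s where s: "awalk ?h s (r ?h)"
      using r[OF V(2)] by (auto simp: scc_of_def reachable_awalk)
    \<comment> \<open>The walk to the head, and the walk to the tail extended by \<open>e\<close>,
      are closed up by the same \<open>s\<close>; its contribution cancels when the two sums are
      compared.\<close>
    have "sum_list (map y (P ?h @ s)) = 0"
      using P[OF V(2)] s by (intro closed[of "r ?h"]) auto
    moreover have "sum_list (map y (P ?t @ e # s)) = 0"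
      using P[OF V(1)] s req e by (intro closed[of "r ?t"]) (auto simp: awalk_Cons_iff)
    ultimately show ?thesis
      by (simp add: \<phi>_def algebra_simps) (metis add.commute add.left_commute add_left_cancel)
  qed
  then show ?thesis by (rule that)
qed

section \<open>The rank of the coboundary map\<close>

text \<open>The value 0 off \<open>arcs G\<close> places the result in the coordinate subspace that
  stands for the edge space of \<open>G\<close>.\<close>

definition coboundary :: "('v, 'e::finite) pre_digraph \<Rightarrow> ('v \<Rightarrow> real) \<Rightarrow> real ^ 'e" where
  "coboundary G \<phi> = (\<chi> e. if e \<in> arcs G then \<phi> (head G e) - \<phi> (tail G e) else 0)"

lemma coboundary_sum:
  "coboundary G (\<lambda>w. \<Sum>v\<in>A. a v * f v w) = (\<Sum>v\<in>A. a v *\<^sub>R coboundary G (f v))"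
  by (simp add: coboundary_def vec_eq_iff sum_subtractf right_diff_distrib)

lemma coboundary_eq_0_reachable:
  assumes "wf_digraph G" "coboundary G \<phi> = 0" "u \<rightarrow>\<^sup>*\<^bsub>G\<^esub> v"
  shows "\<phi> u = \<phi> v"
proof -
  interpret wf_digraph G by fact
  show ?thesis
    using assms(3)
  proof (induction rule: reachable_induct)
    case base
    then show ?case by simp
  next
    case (step x y)
    then obtain e where "e \<in> arcs G" "tail G e = x" "head G e = y"
      by auto
    moreover have "coboundary G \<phi> $ e = 0"
      using assms(2) by simp
    ultimately show ?case
      using step by (simp add: coboundary_def)
  qed
qed

text \<open>The space of all potentials on the vertex type may be infinite-dimensional, so an
  explicit basis of the range is given: the coboundaries of the indicators of all vertices except
  one representative per strong component.\<close>

lemma dim_range_coboundary: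
  assumes "fin_digraph G" "full_digraph G"
  shows "dim (range (coboundary G)) + card (pre_digraph.sccs G) = card (verts G)"
proof -
  interpret fin_digraph G by fact
  define rep where "rep S = (SOME w. w \<in> S)" for S :: "'a set"
  define r where "r v = rep (scc_of v)" for v
  define R where "R = r ` verts G"
  define W where "W = verts G - R"
  define \<delta> where "\<delta> v = coboundary G (\<lambda>w. if w = v then 1 else 0)" for v
  have r_scc: "r v \<in> scc_of v" if "v \<in> verts G" for v
    using someI[of "\<lambda>w. w \<in> scc_of v"] in_scc_of_self[OF that] by (auto simp: r_def rep_def)
  have scc_r: "scc_of (r v) = scc_of v" if "v \<in> verts G" for v
    using r_scc[OF that] by (rule scc_of_eq)
  have R_verts: "R \<subseteq> verts G"
    using r_scc by (force simp: R_def scc_of_def dest: reachable_in_verts)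
  have fin: "finite W" "finite R"
    using R_verts finite_verts by (auto simp: W_def intro: finite_subset)
  \<comment> \<open>\<open>scc_of\<close> recovers a component from its representative, so
    \<open>rep\<close> is injective on components.\<close>
  have card_R: "card R = card sccs"
  proof -
    have "R = rep ` sccs_verts"
      by (auto simp: R_def r_def sccs_verts_conv_scc_of)
    moreover have "inj_on rep sccs_verts"
      by (rule inj_on_inverseI[where g = scc_of])
        (use scc_r in \<open>auto simp: sccs_verts_conv_scc_of r_def\<close>)
    ultimately show ?thesis
      by (simp add: card_image card_sccs_verts)
  qed
  \<comment> \<open>A potential in the kernel is constant on each component, so its values on
    \<open>R\<close> determine it on \<open>verts G\<close>.\<close>
  have zero: "\<phi> v = 0" if "coboundary G \<phi> = 0" "\<And>w. w \<in> R \<Longrightarrow> \<phi> w = 0" "v \<in> verts G" for \<phi> v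
  proof -
    have "\<phi> v = \<phi> (r v)"
      using coboundary_eq_0_reachable[OF _ that(1)] r_scc[OF that(3)] wf_digraph_axioms
      by (auto simp: scc_of_def)
    then show ?thesis using that by (auto simp: R_def)
  qed
  have comb: "(\<Sum>v\<in>W. a v *\<^sub>R \<delta> v) = coboundary G (\<lambda>w. if w \<in> W then a w else 0)" for a
    using fin by (simp add: \<delta>_def flip: coboundary_sum) (simp add: mult_delta_right cong: if_cong)
  have indep: "a v = 0" if "(\<Sum>v\<in>W. a v *\<^sub>R \<delta> v) = 0" "v \<in> W" for a v
    using zero[of "\<lambda>w. if w \<in> W then a w else 0" v] that(2) that(1)[unfolded comb]
    by (simp add: W_def)
  \<comment> \<open>A coincidence would be a linear relation with coefficients 1 and -1. Injectivity
    is what lets \<open>W\<close> count the basis and index sums over it.\<close>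
  have inj: "inj_on \<delta> W"
  proof (rule inj_onI, rule ccontr)
    fix v v' assume v: "v \<in> W" "v' \<in> W" "\<delta> v = \<delta> v'" "v \<noteq> v'"
    let ?a = "\<lambda>w. (if w = v then 1 else 0) - (if w = v' then 1 else 0 :: real)"
    have "(\<Sum>w\<in>W. ?a w *\<^sub>R \<delta> w) = 0"
      using v fin by (simp add: scaleR_left_diff_distrib sum_subtractf if_distrib[of "\<lambda>x. x *\<^sub>R _"] cong: if_cong)
    from indep[OF this v(1)] v(4) show False by simp
  qed
  have "dim (range (coboundary G)) = card W"
  proof (rule dim_unique)
    show "\<delta> ` W \<subseteq> range (coboundary G)"
      by (auto simp: \<delta>_def)
    show "independent (\<delta> ` W)"
      by (rule independent_if_scalars_zero) (use fin indep in \<open>auto simp: sum.reindex[OF inj]\<close>)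
    show "card (\<delta> ` W) = card W"
      by (rule card_image) fact
    show "range (coboundary G) \<subseteq> span (\<delta> ` W)"
    proof clarify
      fix \<phi> :: "'a \<Rightarrow> real"
      \<comment> \<open>The subtracted function is constant on components: the coboundary is
        unchanged, while the new potential vanishes on \<open>R\<close>.\<close>
      let ?\<psi> = "\<lambda>w. \<phi> w - \<phi> (r w)"
      have r_arc: "r (tail G e) = r (head G e)" if e: "e \<in> arcs G" for e
      proof -
        have "tail G e \<rightarrow>\<^sup>*\<^bsub>G\<^esub> head G e"
          using e by (metis in_arcs_imp_in_arcs_ends reachable_adjI)
        then have "tail G e \<in> scc_of (head G e)"
          using full_reachable_sym[OF assms(2)] by (auto simp: scc_of_def)
        then show ?thesis by (simp add: r_def scc_of_eq)
      qed
      have "?\<psi> w = 0" if "w \<in> R" for w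
        using that scc_r by (auto simp: R_def r_def)
      then have "coboundary G (\<lambda>w. if w \<in> W then ?\<psi> w else 0) = coboundary G \<phi>"
        using r_arc by (auto simp: coboundary_def vec_eq_iff W_def)
      then have "coboundary G \<phi> = (\<Sum>v\<in>W. ?\<psi> v *\<^sub>R \<delta> v)"
        by (simp only: comb)
      then show "coboundary G \<phi> \<in> span (\<delta> ` W)"
        by (auto intro!: span_sum span_scale intro: span_base)
    qed
  qed
  moreover have "card W + card R = card (verts G)"
    using fin R_verts by (simp add: W_def card_Diff_subset card_mono finite_verts)
  ultimately show ?thesis
    by (simp add: card_R)
qed

section \<open>Pairing with cycle vectors, and dimension formulas\<close>

lemma (in wf_digraph) awalk_sum_potential:
  fixes \<phi> :: "'a \<Rightarrow> 'c::ab_group_add"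
  assumes "awalk u p v"
  shows "(\<Sum>e\<leftarrow>p. \<phi> (head G e) - \<phi> (tail G e)) = \<phi> v - \<phi> u"
  using assms by (induction p arbitrary: u) (auto simp: awalk_simps)

text \<open>Turns orthogonality to a cycle vector into a vanishing sum along the cycle. For the
  empty list both sides are 0, as division by 0 gives 0.\<close>

lemma inner_cycle_vec: "y \<bullet> cycle_vec p = sum_list (map (($) y) p) / real (length p)"
proof -
  have "(\<Sum>e\<in>UNIV. y $ e * real (count_list p e)) = sum_list (map (($) y) p)"
  proof (induction p)
    case (Cons a p)
    have "y $ e * real (count_list (a # p) e) =
        y $ e * real (count_list p e) + (if e = a then y $ e else 0)" for e
      by (simp add: distrib_left)
    then show ?case
      by (simp only:) (simp add: sum.distrib Cons)
  qed simp
  then show ?thesis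
    by (simp add: cycle_vec_def inner_vec_def flip: sum_divide_distrib)
qed

text \<open>The affine hull misses the origin, so adjoining 0 raises the affine dimension by exactly
  one, and for a set containing 0 affine and linear dimension agree. For empty \<open>S\<close> this
  reads -1 = 0 - 1.\<close>

lemma aff_dim_eq_dim_hyperplane:
  fixes S :: "'a::euclidean_space set"
  assumes "\<And>x. x \<in> S \<Longrightarrow> a \<bullet> x = b" "b \<noteq> 0"
  shows "aff_dim S = int (dim S) - 1"
proof -
  have "affine hull S \<subseteq> {x. a \<bullet> x = b}"
    using assms(1) by (intro hull_minimal affine_hyperplane) auto
  then have "0 \<notin> affine hull S"
    using assms(2) by auto
  then have "aff_dim (insert 0 S) = aff_dim S + 1"
    by (simp add: aff_dim_insert)
  moreover have "aff_dim (insert 0 S) = int (dim S)"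
    by (subst aff_dim_zero) (auto intro: hull_inc simp: dim_insert span_zero)
  ultimately show ?thesis by simp
qed

lemma dim_cart_support:
  "dim {x :: real ^ 'n::finite. \<forall>i. i \<notin> A \<longrightarrow> x $ i = 0} = card A"
proof -
  have "card ((\<lambda>i. axis i (1::real)) ` A) = card A"
    by (rule card_image) (simp add: inj_on_def axis_eq_axis)
  moreover have "(\<lambda>i. axis i (1::real)) ` A \<subseteq> Basis"
    by (auto simp: Basis_vec_def)
  moreover have "{x :: real ^ 'n. \<forall>i. i \<notin> A \<longrightarrow> x $ i = 0} =
      {x. \<forall>b\<in>Basis. b \<notin> (\<lambda>i. axis i 1) ` A \<longrightarrow> x \<bullet> b = 0}"
    by (auto simp: Basis_vec_def inner_axis axis_eq_axis)
  ultimately show ?thesis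
    by (simp add: dim_substandard)
qed

section \<open>The dimension of the polytope of a full digraph\<close>

text \<open>Isolated vertices are allowed: each is a strong component of its own, so its
  contributions to the two counts cancel.\<close>

lemma aff_dim_cycle_polytope_full:
  assumes "fin_digraph G" "full_digraph G"
  shows "aff_dim (cycle_polytope G) =
    int (card (arcs G)) - int (card (verts G)) + int (card (pre_digraph.sccs G)) - 1"
proof -
  interpret fin_digraph G by fact
  define S where "S = {cycle_vec p | p. cycle p}"
  define E where "E = {x :: real ^ 'b. \<forall>e. e \<notin> arcs G \<longrightarrow> x $ e = 0}"
  have cycleD: "\<exists>u. awalk u p u" "p \<noteq> []" "set p \<subseteq> arcs G" if "cycle p" for p
    using that by (auto simp: cycle_def)
  have "count_list p e = 0" if "cycle p" "e \<notin> arcs G" for p e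
    using cycleD(3)[OF that(1)] that(2) by (auto simp: count_list_0_iff)
  then have "S \<subseteq> E"
    by (auto simp: S_def E_def cycle_vec_def)
  moreover have E: "subspace E"
    by (auto simp: E_def subspace_def)
  ultimately have "span S \<subseteq> E"
    by (rule span_minimal)
  \<comment> \<open>Inside \<open>E\<close>, the complement of the cycle space is the cut space. One
    inclusion constructs a potential; the other holds because potential differences telescope to 0
    around a cycle.\<close>
  have "{y \<in> E. \<forall>x\<in>span S. orthogonal x y} = range (coboundary G)"
  proof (intro equalityI subsetI)
    fix y assume "y \<in> {y \<in> E. \<forall>x\<in>span S. orthogonal x y}"
    then have y: "y \<in> E" "\<And>x. x \<in> S \<Longrightarrow> x \<bullet> y = 0"
      by (auto simp: orthogonal_def span_base)
    have "sum_list (map (($) y) p) = 0" if "cycle p" for p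
      using y(2)[of "cycle_vec p"] cycleD(2)[OF that] that
      by (auto simp: S_def inner_commute[of _ y] inner_cycle_vec)
    then obtain \<phi> where "\<And>e. e \<in> arcs G \<Longrightarrow> y $ e = \<phi> (head G e) - \<phi> (tail G e)"
      using full_potential_exists[OF assms(2)] closed_walk_sum_eq_0 by metis
    then have "y = coboundary G \<phi>"
      using y(1) by (simp add: coboundary_def vec_eq_iff E_def)
    then show "y \<in> range (coboundary G)" by simp
  next
    fix y assume "y \<in> range (coboundary G)"
    then obtain \<phi> where \<phi>: "y = coboundary G \<phi>" by auto
    have "orthogonal y x" if x: "x \<in> S" for x
    proof -
      obtain p where p: "x = cycle_vec p" "cycle p"
        using x by (auto simp: S_def)
      have eq: "map (($) y) p = map (\<lambda>e. \<phi> (head G e) - \<phi> (tail G e)) p"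
        using cycleD(3)[OF p(2)] by (auto simp: \<phi> coboundary_def)
      obtain u where "awalk u p u"
        using cycleD(1)[OF p(2)] by auto
      then have "sum_list (map (($) y) p) = 0"
        unfolding eq by (simp add: awalk_sum_potential)
      then show ?thesis
        by (simp add: orthogonal_def p(1) inner_cycle_vec)
    qed
    then have "orthogonal x y" if "x \<in> span S" for x
      using orthogonal_to_span[OF that] orthogonal_commute by metis
    moreover have "y \<in> E"
      by (simp add: \<phi> E_def coboundary_def)
    ultimately show "y \<in> {y \<in> E. \<forall>x\<in>span S. orthogonal x y}" by simp
  qed
  then have "dim (range (coboundary G)) + dim S = card (arcs G)"
    using dim_subspace_orthogonal_to_vectors[OF subspace_span E \<open>span S \<subseteq> E\<close>]
    by (simp add: E_def dim_cart_support)
  moreover have "aff_dim S = int (dim S) - 1"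
  proof (rule aff_dim_eq_dim_hyperplane)
    \<comment> \<open>The all-ones vector pairs to \<open>length p / length p\<close> with a cycle
      vector, which is 1 because cycles are nonempty.\<close>
    have "sum_list (map (($) (\<chi> e. 1)) p) = real (length p)" for p :: "'b list"
      by (induction p) simp_all
    then show "(\<chi> e. 1) \<bullet> x = 1" if "x \<in> S" for x
      using that cycleD(2) by (auto simp: S_def inner_cycle_vec)
  qed simp
  ultimately show ?thesis
    using dim_range_coboundary[OF assms]
    by (simp add: cycle_polytope_def aff_dim_convex_hull flip: S_def)
qed

section \<open>Reduction to the largest full subgraph\<close>

text \<open>A simple cycle is a closed walk, so all its arcs survive in the subgraph. Hence both
  digraphs have the same cycle polytope.\<close>

lemma (in wf_digraph) cycle_largest_full_subgraph:
  "pre_digraph.cycle (largest_full_subgraph G) p \<longleftrightarrow> cycle p"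
proof -
  let ?H = "largest_full_subgraph G"
  have sub: "subgraph ?H G" by (rule largest_full_subgraph_subgraph) unfold_locales
  interpret H: wf_digraph ?H using sub by auto
  have comp: "compatible G ?H" using sub by auto
  show ?thesis
  proof
    assume "H.cycle p"
    then obtain u where u: "H.awalk u p u" "distinct (tl (H.awalk_verts u p))" "p \<noteq> []"
      by (auto simp: H.cycle_def)
    then have "awalk u p u"
      using sub compatible_cas[OF comp] by (auto simp: awalk_def H.awalk_def)
    then show "cycle p"
      using u compatible_awalk_verts[OF comp] by (auto simp: cycle_def)
  next
    assume p: "cycle p"
    then obtain u where u: "awalk u p u" "distinct (tl (awalk_verts u p))" "p \<noteq> []"
      by (auto simp: cycle_def)
    have arcs: "set p \<subseteq> arcs ?H"
      using u by (auto simp: largest_full_subgraph_def Let_def closed_w_def)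
    \<comment> \<open>A walk in the subgraph must start at one of its vertices; \<open>u\<close> is
      one, being the tail of the first arc.\<close>
    then have "hd p \<in> arcs ?H" "tail ?H (hd p) = u"
      using u comp by (auto simp: awalk_def cas_simp compatible_def)
    then have "u \<in> verts ?H" by auto
    then show "H.cycle p"
      using u arcs compatible_awalk_verts[OF comp] compatible_cas[OF comp]
      by (auto simp: H.cycle_def H.awalk_def awalk_def)
  qed
qed

lemma (in wf_digraph) strongly_connected_full_digraph:
  assumes "strongly_connected G"
  shows "full_digraph G"
  unfolding full_digraph_def
proof
  fix e assume e: "e \<in> arcs G"
  then have "head G e \<rightarrow>\<^sup>* tail G e"
    using assms by (auto simp: strongly_connected_def)
  then obtain p where "awalk (head G e) p (tail G e)"
    by (auto simp: reachable_awalk)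
  then have "awalk (tail G e) (e # p) (tail G e)"
    using e by (simp add: awalk_Cons_iff)
  then show "\<exists>p. closed_w p \<and> e \<in> set p"
    by (intro exI[of _ "e # p"]) (auto simp: closed_w_def)
qed

theorem theorem3p1:
  fixes G H :: "('v, 'e::finite) pre_digraph"
  assumes "fin_digraph G"
    and "H = largest_full_subgraph G"
  shows "aff_dim (cycle_polytope G) =
           int (card (arcs H)) - int (card (verts H)) + int (card (weak_components H)) - 1
         \<and> (strongly_connected G \<longrightarrow>
             aff_dim (cycle_polytope G) = int (card (arcs G)) - int (card (verts G)))"
proof
  interpret fin_digraph G by fact
  have sub: "subgraph H G" and full: "full_digraph H"
    using assms(2) largest_full_subgraph_subgraph full_digraph_largest_full_subgraph wf_digraph_axioms
    by auto
  interpret H: fin_digraph H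
    using fin_digraph_subgraph[OF sub] .
  have "cycle_polytope G = cycle_polytope H"
    by (simp add: cycle_polytope_def assms(2) cycle_largest_full_subgraph)
  then show "aff_dim (cycle_polytope G) =
      int (card (arcs H)) - int (card (verts H)) + int (card (weak_components H)) - 1"
    using aff_dim_cycle_polytope_full[OF H.fin_digraph_axioms full]
      H.full_weak_components_eq_sccs[OF full] by simp
  \<comment> \<open>The full case is applied to \<open>G\<close> itself, whose single strong
    component cancels the -1. This also covers one vertex without arcs, where \<open>H\<close> has
    no vertices and differs from \<open>G\<close>.\<close>
  show "strongly_connected G \<longrightarrow>
      aff_dim (cycle_polytope G) = int (card (arcs G)) - int (card (verts G))"
    using aff_dim_cycle_polytope_full[OF assms(1)] strongly_connected_full_digraph
    by (simp add: strongly_connected_eq_iff)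
qed

end
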